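(* Let $k\geq 2$ be an integer and let $\{b_k(n)\}_{n=0}^{\infty}$ be the Bell numbers of order $k$. Then the sequence $\{b_k(n)/n!\}_{n=0}^{\infty}$ is log-concave and the sequence $\{b_k(n)\}_{n=0}^{\infty}$ is log-convex. Equivalently, $$1\leq \frac{b_k(n)\,b_k(n+2)}{b_k(n+1)^2}\leq \frac{n+2}{n+1}\quad\text{for all } n\geq 0.$$
   Context: For an integer $k\geq 2$, let $\exp_k(x)$ denote the $k$-times iterated exponential $\exp(\exp(\cdots\exp(x)\cdots))$ ($k$ exponentials). Define $B_k(n)$ by the power series $\exp_k(x)=\sum_{n=0}^\infty \frac{B_k(n)}{n!}x^n$. The Bell numbers of order $k$ are $b_k(n)=B_k(n)/\exp_k(0)$, $n\geq 0$. A sequence $\{\delta(n)\}_{n\ge0}$ of nonnegative reals is log-concave if $\delta(n)\delta(n+2)\leq\delta(n+1)^2$ for all $n\geq 0$, and log-convex if $\delta(n)\delta(n+2)\geq \delta(n+1)^2$ for all $n\geq0$. *)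

theory Defs
  imports "HOL-Complex_Analysis.Complex_Analysis"
begin

definition iter_exp :: "nat \<Rightarrow> real \<Rightarrow> real" where
  "iter_exp k = exp ^^ k"

text \<open>
  The coefficients of the exponential generating function \<open>iter_exp k\<close>. The description is
  proper: see \<open>bell_egf_coeff_sums\<close> (existence) and \<open>bell_egf_coeff_unique\<close> (uniqueness) below.
\<close>
definition bell_egf_coeff :: "nat \<Rightarrow> nat \<Rightarrow> real" where
  "bell_egf_coeff k = (THE B. \<forall>x. (\<lambda>n. B n / fact n * x ^ n) sums iter_exp k x)"

definition bell_order :: "nat \<Rightarrow> nat \<Rightarrow> real" where
  "bell_order k n = bell_egf_coeff k n / iter_exp k 0"

definition log_concave_seq :: "(nat \<Rightarrow> real) \<Rightarrow> bool" where
  "log_concave_seq \<delta> \<longleftrightarrow> (\<forall>n. 0 \<le> \<delta> n) \<and> (\<forall>n. \<delta> n * \<delta> (n + 2) \<le> (\<delta> (n + 1))\<^sup>2)"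

definition log_convex_seq :: "(nat \<Rightarrow> real) \<Rightarrow> bool" where
  "log_convex_seq \<delta> \<longleftrightarrow> (\<forall>n. 0 \<le> \<delta> n) \<and> (\<forall>n. \<delta> n * \<delta> (n + 2) \<ge> (\<delta> (n + 1))\<^sup>2)"

lemma iter_exp_power_series_exists:
  "\<exists>B. \<forall>x. (\<lambda>n. B n / fact n * x ^ n) sums iter_exp k x"
proof -
  let ?f = "exp ^^ k :: complex \<Rightarrow> complex"
  have hol: "?f holomorphic_on UNIV"
  proof (induction k)
    case (Suc k)
    then have "(\<lambda>z. exp ((exp ^^ k) z :: complex)) holomorphic_on UNIV"
      by (rule holomorphic_on_exp')
    then show ?case by (simp add: o_def)
  qed (simp add: id_def)
  have of_real: "?f (of_real x) = of_real (iter_exp k x)" for x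
    unfolding iter_exp_def by (induction k) (simp_all flip: exp_of_real)
  define B where "B n = Re ((deriv ^^ n) ?f 0)" for n
  have "(\<lambda>n. B n / fact n * x ^ n) sums iter_exp k x" for x
  proof -
    have "(\<lambda>n. (deriv ^^ n) ?f 0 / fact n * (of_real x - 0) ^ n) sums ?f (of_real x)"
      by (rule holomorphic_power_series[where r = "\<bar>x\<bar> + 1"])
        (use hol in \<open>auto intro: holomorphic_on_subset\<close>)
    then have "(\<lambda>n. Re ((deriv ^^ n) ?f 0 / fact n * of_real x ^ n)) sums Re (?f (of_real x))"
      by (intro sums_Re) simp
    moreover have "Re ((deriv ^^ n) ?f 0 / fact n * of_real x ^ n) = B n / fact n * x ^ n" for n
    proof -
      have "(deriv ^^ n) ?f 0 / fact n * of_real x ^ n = (x ^ n / fact n) *\<^sub>R (deriv ^^ n) ?f 0"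
        by (simp add: scaleR_conv_of_real)
      then show ?thesis
        by (simp add: B_def del: of_real_power)
    qed
    ultimately show ?thesis by (simp add: of_real)
  qed
  then show ?thesis by blast
qed

lemma iter_exp_power_series_unique:
  assumes "\<forall>x. (\<lambda>n. B n / fact n * x ^ n) sums iter_exp k x"
    and "\<forall>x. (\<lambda>n. C n / fact n * x ^ n) sums iter_exp k x"
  shows "B = C"
proof -
  define d where "d n = B n / fact n - C n / fact n" for n
  have sums: "(\<lambda>n. d n * x ^ n) sums 0" for x
    using sums_diff[OF assms(1)[rule_format, of x] assms(2)[rule_format, of x]] by (simp add: d_def algebra_simps)
  have "d n = 0" for n
  proof (induction n rule: less_induct)
    case (less n)
    have "(\<lambda>i. d (i + n) * x ^ i) sums 0" if "x \<noteq> 0" for x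
    proof -
      have "(\<lambda>i. d (i + n) * x ^ (i + n)) sums 0"
        using sums[of x] less by (subst sums_zero_iff_shift) auto
      then have "(\<lambda>i. d (i + n) * x ^ (i + n) / x ^ n) sums (0 / x ^ n)"
        by (rule sums_divide)
      then show ?thesis
        using that by (simp add: power_add)
    qed
    then have "((\<lambda>x. 0) \<longlongrightarrow> d (0 + n)) (at (0 :: real))"
      by (intro powser_limit_0_strong[where s = 1]) auto
    then show ?case
      by (simp add: tendsto_const_iff)
  qed
  then show ?thesis
    by (auto simp: d_def fun_eq_iff)
qed

lemma bell_egf_coeff_sums: "(\<lambda>n. bell_egf_coeff k n / fact n * x ^ n) sums iter_exp k x"
proof -
  have "\<exists>!B. \<forall>x. (\<lambda>n. B n / fact n * x ^ n) sums iter_exp k x"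
    using iter_exp_power_series_exists iter_exp_power_series_unique by blast
  from theI'[OF this] show ?thesis
    unfolding bell_egf_coeff_def by blast
qed

lemma bell_egf_coeff_unique:
  "(\<And>x. (\<lambda>n. B n / fact n * x ^ n) sums iter_exp k x) \<Longrightarrow> B = bell_egf_coeff k"
  using bell_egf_coeff_sums iter_exp_power_series_unique by blast

end

theory Submission
  imports Defs
begin

text \<open>
  If \<open>exp (\<Sum>j\<ge>1. z j * x ^ j / j) = (\<Sum>n. a n * x ^ n)\<close>, then
  \<open>(n + 1) * a (n + 1) = (\<Sum>i\<le>n. z (i + 1) * a (n - i))\<close>. Setting \<open>z 0 = 1\<close> one also has
  \<open>(n + 1) * a n = (\<Sum>i\<le>n. z i * a (n - i))\<close>, so \<open>a (n + 1)\<^sup>2 - a n * a (n + 2)\<close> is, up to a positive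
  factor, a double sum; symmetrising it exhibits every term as a product of a minor of \<open>z\<close> and
  a minor of \<open>a\<close> with indices at most \<open>n + 1\<close>. Hence log-concavity of \<open>z\<close> passes to \<open>a\<close> by induction, and
  log-convexity of \<open>n! * a n\<close> follows from the recurrence term by term (Bender and Canfield).
  For iterated exponentials, \<open>z j\<close> is \<open>j\<close> times the \<open>j\<close>-th Taylor coefficient of the previous iterate,
  so the result follows by induction on \<open>k\<close>; the only inequality to be carried along is
  \<open>z 2 \<le> (z 1)\<^sup>2\<close>, which reduces to \<open>exp_k(0) \<ge> 2\<close> for \<open>k \<ge> 2\<close>.
\<close>

section \<open>Log-concavity and exponentials of power series\<close>

lemma log_concave_minor:
  fixes a :: "nat \<Rightarrow> real"
  assumes pos: "\<And>m. a m > 0"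
    and lc: "\<And>m. m + 2 \<le> N \<Longrightarrow> a m * a (m + 2) \<le> (a (m + 1))\<^sup>2"
    and "p \<le> q" "q < N"
  shows "a p * a (Suc q) \<le> a (Suc p) * a q"
  using \<open>p \<le> q\<close> \<open>q < N\<close>
proof (induction q rule: dec_induct)
  case base
  then show ?case by (simp add: mult.commute)
next
  case (step q)
  \<comment> \<open>Multiplying the induction hypothesis by log-concavity at \<open>q\<close>
    produces the common positive factor \<open>a q * a (Suc q)\<close>, which cancels.\<close>
  have "(a p * a (Suc q)) * (a q * a (Suc (Suc q))) \<le> (a (Suc p) * a q) * (a (Suc q))\<^sup>2"
    using step lc[of q] less_imp_le[OF pos] by (intro mult_mono[of "_ * _" "_ * _"]) auto
  then have "(a q * a (Suc q)) * (a p * a (Suc (Suc q))) \<le> (a q * a (Suc q)) * (a (Suc p) * a (Suc q))"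
    by (simp add: power2_eq_square ac_simps)
  then show ?case
    using pos by (simp add: mult_le_cancel_left_pos)
qed

context
  fixes a z :: "nat \<Rightarrow> real"
  assumes z_0: "z 0 = 1" and z_pos: "\<And>n. z n > 0"
    and z_log_concave: "\<And>n. z n * z (n + 2) \<le> (z (n + 1))\<^sup>2"
    and a_0: "a 0 > 0"
    and rec: "\<And>n. real (Suc n) * a (Suc n) = (\<Sum>i\<le>n. z (Suc i) * a (n - i))"
begin

lemma exp_coeff_pos: "a n > 0"
proof (induction n rule: less_induct)
  case (less n)
  show ?case
  proof (cases n)
    case (Suc m)
    have "real (Suc m) * a (Suc m) > 0"
      unfolding rec using less Suc z_pos by (intro sum_pos) auto
    then show ?thesis
      using Suc by (simp add: zero_less_mult_iff)
  qed (simp add: a_0)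
qed

lemma exp_coeff_log_concave: "a n * a (n + 2) \<le> (a (n + 1))\<^sup>2"
proof (induction n rule: less_induct)
  case (less n)
  define N where "N = Suc n"
  \<comment> \<open>Shifting \<open>a\<close> by one makes sense of \<open>a (-1) = 0\<close>, so that all sums run over \<open>{..N}\<close>.\<close>
  define c where "c = case_nat 0 a"
  have c_simps [simp]: "c 0 = 0" "c (Suc m) = a m" for m
    by (simp_all add: c_def)
  have z_minor: "z j * z (Suc i) \<le> z (Suc j) * z i" if "j \<le> i" for i j
    by (rule log_concave_minor[where N = "Suc i"]) (use z_pos z_log_concave that in auto)
  have c_minor: "c p * c (Suc q) \<le> c (Suc p) * c q" if "p \<le> q" "q \<le> N" for p q
  proof (cases p)
    case (Suc p')
    then obtain q' where "q = Suc q'"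
      using \<open>p \<le> q\<close> by (cases q) auto
    \<comment> \<open>The induction hypothesis covers exactly the triples of \<open>a\<close> with
      indices up to \<open>N\<close>; here \<open>q' < N\<close>.\<close>
    moreover have "a p' * a (Suc q') \<le> a (Suc p') * a q'"
      by (rule log_concave_minor[where N = N])
        (use exp_coeff_pos less.IH that Suc \<open>q = Suc q'\<close> in \<open>auto simp: N_def\<close>)
    ultimately show ?thesis
      using Suc by simp
  next
    case 0
    then show ?thesis
      using exp_coeff_pos by (cases q) (auto intro: less_imp_le)
  qed
  have conv1: "(\<Sum>i\<le>m. z (Suc i) * c (m - i)) = m * c (Suc m)" for m
  proof (cases m)
    case (Suc m')
    then show ?thesis
      using rec[of m'] by (simp add: Suc_diff_le)
  qed simp
  \<comment> \<open>The term \<open>z 0 * c m = c m\<close> raises the factor \<open>m - 1\<close>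
    coming from \<open>conv1\<close> to \<open>m\<close>.\<close>
  have conv0: "(\<Sum>j\<le>m. z j * c (m - j)) = m * c m" for m
  proof (cases m)
    case (Suc m')
    then show ?thesis
      using conv1[of m'] z_0 by (simp add: sum.atMost_Suc_shift algebra_simps del: sum.atMost_Suc)
  qed simp
  define X where "X i j = c (Suc N - j) * c (N - i) - c (N - j) * c (Suc N - i)" for i j
  define S where "S = (\<Sum>i\<le>N. \<Sum>j\<le>N. z (Suc i) * z j * X i j)"
  have "S = (\<Sum>i\<le>N. z (Suc i) * c (N - i)) * (\<Sum>j\<le>N. z j * c (Suc N - j))
          - (\<Sum>i\<le>N. z (Suc i) * c (Suc N - i)) * (\<Sum>j\<le>N. z j * c (N - j))"
    unfolding S_def X_def sum_product sum_subtractf[symmetric]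
    by (intro sum.cong refl) (simp add: algebra_simps)
  \<comment> \<open>Extending the range to \<open>Suc N\<close> only adds a multiple of
    \<open>c 0 = 0\<close>.\<close>
  also have "(\<Sum>j\<le>N. z j * c (Suc N - j)) = Suc N * c (Suc N)"
    using conv0[of "Suc N"] by simp
  also have "(\<Sum>i\<le>N. z (Suc i) * c (Suc N - i)) = Suc N * c (Suc (Suc N))"
    using conv1[of "Suc N"] by simp
  finally have S_eq: "S = real N * real (Suc N) * ((a (n + 1))\<^sup>2 - a n * a (n + 2))"
    unfolding conv0 conv1 by (simp add: N_def power2_eq_square algebra_simps)
  have X_antisym: "X j i = - X i j" for i j
    by (simp add: X_def)
  have nonneg: "(z (Suc i) * z j - z (Suc j) * z i) * X i j \<ge> 0" if "j \<le> i" "i \<le> N" for i j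
  proof (rule mult_nonpos_nonpos)
    show "z (Suc i) * z j - z (Suc j) * z i \<le> 0"
      using z_minor[OF \<open>j \<le> i\<close>] by (simp add: mult.commute)
    show "X i j \<le> 0"
      using c_minor[of "N - i" "N - j"] that by (simp add: X_def Suc_diff_le mult.commute)
  qed
  \<comment> \<open>Adding the copy of \<open>S\<close> with \<open>i\<close> and \<open>j\<close>
    exchanged and using the antisymmetry of \<open>X\<close> turns each coefficient into a minor of
    \<open>z\<close>.\<close>
  have "2 * S = S + (\<Sum>j\<le>N. \<Sum>i\<le>N. z (Suc i) * z j * X i j)"
    unfolding S_def by (subst (2) sum.swap) simp
  also have "\<dots> = (\<Sum>i\<le>N. \<Sum>j\<le>N. (z (Suc i) * z j - z (Suc j) * z i) * X i j)"
    unfolding S_def sum.distrib[symmetric]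
    by (intro sum.cong refl) (subst (2) X_antisym, simp add: algebra_simps)
  also have "\<dots> \<ge> 0"
  proof (intro sum_nonneg)
    \<comment> \<open>Exchanging \<open>i\<close> and \<open>j\<close> flips the sign of both
      factors, so the case \<open>j \<le> i\<close> suffices.\<close>
    fix i j assume "i \<in> {..N}" "j \<in> {..N}"
    then show "(z (Suc i) * z j - z (Suc j) * z i) * X i j \<ge> 0"
      using nonneg[of j i] nonneg[of i j] X_antisym[of i j]
      by (cases "j \<le> i") (auto simp: algebra_simps)
  qed
  finally have "S \<ge> 0"
    by simp
  then show ?case
    unfolding S_eq by (subst (asm) zero_le_mult_iff) (auto simp: N_def mult_le_0_iff)
qed

lemma exp_coeff_fact_log_convex: "real (n + 1) * (a (n + 1))\<^sup>2 \<le> real (n + 2) * (a n * a (n + 2))"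
proof -
  have "real (n + 1) * (a (n + 1))\<^sup>2 = (\<Sum>i\<le>n. z (Suc i) * a (n - i)) * a (Suc n)"
    unfolding rec[symmetric] by (simp add: power2_eq_square)
  also have "\<dots> = (\<Sum>i\<le>n. z (Suc i) * (a (n - i) * a (Suc n)))"
    by (simp add: sum_distrib_right mult.assoc)
  \<comment> \<open>Moving the shift from one factor to the other yields the recurrence sum for
    \<open>a (n + 2)\<close>, up to its last, nonnegative term.\<close>
  also have "\<dots> \<le> (\<Sum>i\<le>n. z (Suc i) * (a (Suc n - i) * a n))"
  proof (intro sum_mono mult_left_mono)
    fix i assume "i \<in> {..n}"
    then show "a (n - i) * a (Suc n) \<le> a (Suc n - i) * a n"
      using log_concave_minor[of a "Suc n" "n - i" n] exp_coeff_pos exp_coeff_log_concave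
      by (simp add: Suc_diff_le)
  qed (simp add: less_imp_le z_pos)
  also have "\<dots> \<le> (\<Sum>i\<le>Suc n. z (Suc i) * (a (Suc n - i) * a n))"
    using less_imp_le[OF z_pos] less_imp_le[OF exp_coeff_pos] by simp
  also have "\<dots> = (real (Suc (Suc n)) * a (Suc (Suc n))) * a n"
    unfolding rec by (simp only: sum_distrib_right mult.assoc)
  finally show ?thesis
    by (simp add: algebra_simps)
qed

end

section \<open>Taylor coefficients of iterated exponentials\<close>

definition iter_exp_coeff :: "nat \<Rightarrow> nat \<Rightarrow> real" where
  "iter_exp_coeff k n = bell_egf_coeff k n / fact n"

lemma iter_exp_Suc: "iter_exp (Suc k) = (\<lambda>x. exp (iter_exp k x))"
  by (simp add: iter_exp_def fun_eq_iff)

lemma iter_exp_pos: "k \<ge> 1 \<Longrightarrow> iter_exp k x > 0"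
  by (cases k) (simp_all add: iter_exp_Suc)

lemma iter_exp_0_ge_1: "k \<ge> 1 \<Longrightarrow> iter_exp k 0 \<ge> 1"
proof (induction k rule: dec_induct)
  case (step k)
  then show ?case
    using exp_ge_add_one_self[of "iter_exp k 0"] unfolding iter_exp_Suc by linarith
qed (simp add: iter_exp_def)

lemma iter_exp_has_fps_expansion: "iter_exp k has_fps_expansion Abs_fps (iter_exp_coeff k)"
proof -
  have sums: "(\<lambda>n. fps_nth (Abs_fps (iter_exp_coeff k)) n * x ^ n) sums iter_exp k x" for x
    using bell_egf_coeff_sums[of k x] by (simp add: iter_exp_coeff_def)
  have "fps_conv_radius (Abs_fps (iter_exp_coeff k)) = \<infinity>"
    unfolding fps_conv_radius_def by (rule conv_radius_inftyI'') (use sums sums_summable in blast)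
  then show ?thesis
    using sums_unique[OF sums, symmetric] by (simp add: has_fps_expansion_def eval_fps_def)
qed

text \<open>Each coefficient is recovered from the derivatives of \<open>f\<close> at 0. This lets a
  differential equation be read as an identity of formal series.\<close>

lemma fps_expansion_unique_real:
  fixes F G :: "real fps"
  assumes "f has_fps_expansion F" "f has_fps_expansion G"
  shows "F = G"
proof -
  have "fps_nth H n = (deriv ^^ n) f 0 / fact n" if "f has_fps_expansion H" for H :: "real fps" and n
  proof -
    have "(deriv ^^ n) f has_fps_expansion (fps_deriv ^^ n) H"
      using that by (induction n) (auto intro: has_fps_expansion_deriv)
    then show ?thesis
      using has_fps_expansion_imp_0_eq_fps_nth_0 by (fastforce simp: fps_0th_higher_deriv)
  qed
  then show ?thesis
    using assms by (metis fps_ext)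
qed

lemma iter_exp_differentiable: "iter_exp k field_differentiable at x"
proof (induction k)
  case 0
  then show ?case by (simp add: iter_exp_def id_def)
next
  case (Suc k)
  then show ?case
    unfolding iter_exp_Suc field_differentiable_def by (blast intro: DERIV_fun_exp)
qed

lemma deriv_iter_exp_Suc: "deriv (iter_exp (Suc k)) x = iter_exp (Suc k) x * deriv (iter_exp k) x"
proof -
  have "(iter_exp k has_field_derivative deriv (iter_exp k) x) (at x)"
    using iter_exp_differentiable by (rule field_differentiable_derivI)
  then have "((\<lambda>x. exp (iter_exp k x)) has_field_derivative exp (iter_exp k x) * deriv (iter_exp k) x) (at x)"
    by (rule DERIV_fun_exp)
  then show ?thesis
    unfolding iter_exp_Suc by (rule DERIV_imp_deriv)
qed

text \<open>Compare coefficients in f' = g' f, where g is \<open>iter_exp k\<close> and f =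
  exp(g).\<close>

lemma iter_exp_coeff_rec:
  "real (Suc n) * iter_exp_coeff (Suc k) (Suc n) =
    (\<Sum>i\<le>n. (real (Suc i) * iter_exp_coeff k (Suc i)) * iter_exp_coeff (Suc k) (n - i))"
proof -
  let ?F = "\<lambda>k. Abs_fps (iter_exp_coeff k)"
  have "deriv (iter_exp (Suc k)) has_fps_expansion fps_deriv (?F (Suc k))"
    by (intro has_fps_expansion_deriv iter_exp_has_fps_expansion)
  moreover have "(\<lambda>x. deriv (iter_exp k) x * iter_exp (Suc k) x)
      has_fps_expansion fps_deriv (?F k) * ?F (Suc k)"
    by (intro has_fps_expansion_mult has_fps_expansion_deriv iter_exp_has_fps_expansion)
  moreover have "deriv (iter_exp (Suc k)) = (\<lambda>x. deriv (iter_exp k) x * iter_exp (Suc k) x)"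
    by (simp add: fun_eq_iff deriv_iter_exp_Suc)
  ultimately have "fps_deriv (?F (Suc k)) = fps_deriv (?F k) * ?F (Suc k)"
    by (metis fps_expansion_unique_real)
  then have "fps_nth (fps_deriv (?F (Suc k))) n = fps_nth (fps_deriv (?F k) * ?F (Suc k)) n"
    by simp
  then show ?thesis
    by (simp add: fps_mult_nth atLeast0AtMost)
qed

lemma iter_exp_coeff_0: "iter_exp_coeff k 0 = iter_exp k 0"
  using has_fps_expansion_imp_0_eq_fps_nth_0[OF iter_exp_has_fps_expansion[of k]] by simp

lemma iter_exp_coeff_1: "iter_exp_coeff 1 n = 1 / fact n"
proof -
  have "(\<lambda>n. 1 / fact n * x ^ n) sums iter_exp 1 x" for x
    using exp_converges[of x] by (simp add: iter_exp_def field_simps)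
  then have "(\<lambda>_. 1) = bell_egf_coeff 1"
    by (rule bell_egf_coeff_unique)
  then show ?thesis
    by (metis iter_exp_coeff_def)
qed

section \<open>Induction on the order\<close>

text \<open>For \<open>n > 0\<close> this uses n(n+2) \<le> (n+1)^2; for \<open>n = 0\<close> the
  convention \<open>z 0 = 1\<close> makes it the separate hypothesis \<open>2\<close>.\<close>

lemma log_concave_times_index:
  fixes a :: "nat \<Rightarrow> real"
  assumes pos: "\<And>n. a n > 0" and lc: "\<And>n. a n * a (n + 2) \<le> (a (n + 1))\<^sup>2"
    and 2: "2 * a 2 \<le> (a 1)\<^sup>2"
  defines "z \<equiv> \<lambda>n. if n = 0 then 1 else real n * a n"
  shows "z n * z (n + 2) \<le> (z (n + 1))\<^sup>2"
proof (cases "n = 0")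
  case False
  have "real n * real (n + 2) * (a n * a (n + 2)) \<le> (real (n + 1))\<^sup>2 * (a (n + 1))\<^sup>2"
    using lc less_imp_le[OF pos]
    by (intro mult_mono) (auto simp: power2_eq_square algebra_simps)
  then show ?thesis
    using False by (simp add: z_def power_mult_distrib ac_simps)
qed (use 2 in \<open>simp add: z_def numeral_2_eq_2\<close>)

lemma iter_exp_coeff_Suc:
  assumes pos: "\<And>n. iter_exp_coeff k n > 0"
    and lc: "\<And>n. iter_exp_coeff k n * iter_exp_coeff k (n + 2) \<le> (iter_exp_coeff k (n + 1))\<^sup>2"
    and 2: "2 * iter_exp_coeff k 2 \<le> (iter_exp_coeff k 1)\<^sup>2"
  defines "a \<equiv> iter_exp_coeff (Suc k)"
  shows "a n > 0" "a n * a (n + 2) \<le> (a (n + 1))\<^sup>2"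
    "real (n + 1) * (a (n + 1))\<^sup>2 \<le> real (n + 2) * (a n * a (n + 2))"
proof -
  define z where "z = (\<lambda>n. if n = 0 then 1 else real n * iter_exp_coeff k n)"
  have z: "z 0 = 1" "\<And>n. z n > 0" "\<And>n. z n * z (n + 2) \<le> (z (n + 1))\<^sup>2"
    using log_concave_times_index[of "iter_exp_coeff k", OF pos lc 2] pos by (auto simp: z_def)
  have a: "a 0 > 0" "\<And>n. real (Suc n) * a (Suc n) = (\<Sum>i\<le>n. z (Suc i) * a (n - i))"
    using iter_exp_pos[of "Suc k" 0] iter_exp_coeff_rec[of _ k]
    by (simp_all add: a_def z_def iter_exp_coeff_0)
  show "a n > 0" "a n * a (n + 2) \<le> (a (n + 1))\<^sup>2"
    "real (n + 1) * (a (n + 1))\<^sup>2 \<le> real (n + 2) * (a n * a (n + 2))"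
    using exp_coeff_pos[OF z a] exp_coeff_log_concave[OF z a] exp_coeff_fact_log_convex[OF z a]
    by blast+
qed

lemma iter_exp_coeff_2_Suc:
  assumes "k \<ge> 1" and IH: "2 * iter_exp_coeff k 2 \<le> (iter_exp_coeff k 1)\<^sup>2"
  shows "2 * iter_exp_coeff (Suc k) 2 \<le> (iter_exp_coeff (Suc k) 1)\<^sup>2"
proof -
  define e where "e = iter_exp (Suc k) 0"
  define b where "b = iter_exp_coeff k 1"
  \<comment> \<open>From exp(x) \<ge> 1 + x at x = \<open>iter_exp k 0\<close>, which is at least
    1.\<close>
  have "e \<ge> 2"
    using iter_exp_0_ge_1[OF \<open>k \<ge> 1\<close>] exp_ge_add_one_self[of "iter_exp k 0"]
    unfolding e_def iter_exp_Suc by linarith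
  have 1: "iter_exp_coeff (Suc k) 1 = b * e"
    using iter_exp_coeff_rec[of 0 k] by (simp add: b_def e_def iter_exp_coeff_0)
  have "2 * iter_exp_coeff (Suc k) 2 = e * (b\<^sup>2 + 2 * iter_exp_coeff k 2)"
    using iter_exp_coeff_rec[of 1 k] 1
    by (simp add: b_def e_def iter_exp_coeff_0 numeral_2_eq_2 power2_eq_square algebra_simps)
  also have "\<dots> \<le> e * (2 * b\<^sup>2)"
    using IH \<open>e \<ge> 2\<close> by (intro mult_left_mono) (auto simp: b_def)
  also have "\<dots> \<le> e * (e * b\<^sup>2)"
    using \<open>e \<ge> 2\<close> by (intro mult_left_mono mult_right_mono) auto
  finally show ?thesis
    unfolding 1 by (simp add: power2_eq_square ac_simps)
qed

text \<open>The induction starts at \<open>k = 1\<close>, since \<open>iter_exp 0\<close> is the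
  identity and has vanishing coefficients. At \<open>k = 1\<close> the last clause is an
  equality.\<close>

lemma iter_exp_coeff_properties:
  assumes "k \<ge> 1"
  shows "(\<forall>n. iter_exp_coeff k n > 0)
    \<and> (\<forall>n. iter_exp_coeff k n * iter_exp_coeff k (n + 2) \<le> (iter_exp_coeff k (n + 1))\<^sup>2)
    \<and> 2 * iter_exp_coeff k 2 \<le> (iter_exp_coeff k 1)\<^sup>2"
  using assms
proof (induction k rule: dec_induct)
  case base
  have "1 / fact n * (1 / fact (n + 2)) \<le> (1 / fact (n + 1) :: real)\<^sup>2" for n
    by (simp add: power2_eq_square divide_simps)
  then show ?case
    unfolding iter_exp_coeff_1 by simp
next
  case (step k)
  then show ?case
    using iter_exp_coeff_Suc[of k] iter_exp_coeff_2_Suc[of k] by blast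
qed

section \<open>Bounds for the Bell numbers of order k\<close>

theorem theorem1:
  fixes k :: nat
  assumes "k \<ge> 2"
  shows "log_concave_seq (\<lambda>n. bell_order k n / fact n)
    \<and> log_convex_seq (bell_order k)
    \<and> (\<forall>n. 1 \<le> bell_order k n * bell_order k (n + 2) / (bell_order k (n + 1))\<^sup>2
         \<and> bell_order k n * bell_order k (n + 2) / (bell_order k (n + 1))\<^sup>2
             \<le> (real n + 2) / (real n + 1))"
proof -
  \<comment> \<open>Log-convexity is gained in the last exponentiation, from \<open>k'\<close> to
    \<open>k\<close>.\<close>
  obtain k' where k: "k = Suc k'" "k' \<ge> 1"
    using assms by (cases k) auto
  define e where "e = iter_exp k 0"
  have "e > 0"
    using iter_exp_pos[of k] assms by (simp add: e_def)
  define \<beta> where "\<beta> n = iter_exp_coeff k n / e" for n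
  have bell: "bell_order k n = fact n * \<beta> n" for n
    by (simp add: bell_order_def \<beta>_def e_def iter_exp_coeff_def)
  note coeff = iter_exp_coeff_Suc[of k', folded k(1)]
  have \<beta>_pos: "\<beta> n > 0" for n
    using coeff(1) iter_exp_coeff_properties[of k'] k \<open>e > 0\<close> by (simp add: \<beta>_def)
  have concave: "\<beta> n * \<beta> (n + 2) \<le> (\<beta> (n + 1))\<^sup>2" for n
    using coeff(2)[of n] iter_exp_coeff_properties[of k'] k \<open>e > 0\<close>
    by (simp add: \<beta>_def power2_eq_square divide_right_mono)
  have convex: "real (n + 1) * (\<beta> (n + 1))\<^sup>2 \<le> real (n + 2) * (\<beta> n * \<beta> (n + 2))" for n
    using divide_right_mono[OF coeff(3)[of n], of "e\<^sup>2"] iter_exp_coeff_properties[of k'] k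
    by (simp add: \<beta>_def power2_eq_square)
  \<comment> \<open>Pulling out n! (n+1)! from both sides leaves the factors n+2 and n+1, whose
    quotient is the upper bound.\<close>
  have prod: "bell_order k n * bell_order k (n + 2)
      = (fact n * fact (n + 1)) * (real (n + 2) * (\<beta> n * \<beta> (n + 2)))"
    and square: "(bell_order k (n + 1))\<^sup>2
      = (fact n * fact (n + 1)) * (real (n + 1) * (\<beta> (n + 1))\<^sup>2)" for n
    by (simp_all add: bell power2_eq_square algebra_simps)
  have ge: "(bell_order k (n + 1))\<^sup>2 \<le> bell_order k n * bell_order k (n + 2)" for n
    unfolding prod square by (intro mult_left_mono convex) simp
  have square_pos: "(bell_order k (n + 1))\<^sup>2 > 0" for n
    unfolding bell using \<beta>_pos[of "n + 1"] by (intro zero_less_power mult_pos_pos) auto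
  have le: "bell_order k n * bell_order k (n + 2) / (bell_order k (n + 1))\<^sup>2
      \<le> (real n + 2) / (real n + 1)" for n
  proof -
    have "bell_order k n * bell_order k (n + 2) / (bell_order k (n + 1))\<^sup>2
        = (real (n + 2) / real (n + 1)) * (\<beta> n * \<beta> (n + 2) / (\<beta> (n + 1))\<^sup>2)"
      unfolding prod square by simp
    also have "\<dots> \<le> (real (n + 2) / real (n + 1)) * 1"
      using concave[of n] \<beta>_pos[of "n + 1"] by (intro mult_left_mono) auto
    finally show ?thesis
      by (simp add: add.commute)
  qed
  have "log_concave_seq (\<lambda>n. bell_order k n / fact n)"
    using concave less_imp_le[OF \<beta>_pos] by (simp add: log_concave_seq_def bell del: fact_Suc)
  moreover have "log_convex_seq (bell_order k)"
    using ge less_imp_le[OF \<beta>_pos] by (simp add: log_convex_seq_def) (simp add: bell)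
  moreover have "1 \<le> bell_order k n * bell_order k (n + 2) / (bell_order k (n + 1))\<^sup>2" for n
    using ge[of n] square_pos[of n] by (simp add: le_divide_eq)
  ultimately show ?thesis
    using le by blast
qed

end
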